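(* Let $k\ge 3$ and let $G$ be a $k$-graph with vertex set $\{1,\dots,n\}$, vertex degrees $d_1,\dots,d_n$ (all positive) and Laplacian tensor $\mathcal L$. For each $j=1,\dots,n$, $d_j$ is a strict H$^+$-eigenvalue of $\mathcal L$ with H-eigenvector $\mathbf e^{(j)}$. Zero is the unique H$^{++}$-eigenvalue of $\mathcal L$, with H-eigenvector $\mathbf 1$, and zero is the smallest H-eigenvalue of $\mathcal L$.
   Context: A $k$-graph $G=(V,E)$ consists of a vertex set $V=\{1,\dots,n\}$ and a set $E$ of distinct $k$-element subsets of $V$ (edges). Standing assumption: every vertex lies in at least one edge. The degree $d_i$ of vertex $i$ is the number of edges containing $i$. The adjacency tensor $\mathcal A=(a_{i_1\cdots i_k})$ is the $k$th order $n$-dimensional symmetric tensor with $a_{i_1\cdots i_k}=\frac1{(k-1)!}$ if $\{i_1,\dots,i_k\}\in E$ (in particular the indices are then distinct), and $0$ otherwise. The degree tensor $\mathcal D$ is the $k$th order $n$-dimensional diagonal tensor with $i$th diagonal entry $d_i$. The Laplacian tensor is $\mathcal L=\mathcal D-\mathcal A$. For a real $k$th order $n$-dimensional tensor $\mathcal T=(t_{i_1\cdots i_k})$ and a vector $x$, $\mathcal Tx^{k-1}$ is the vector with $i$th component $\sum_{i_2,\dots,i_k=1}^n t_{ii_2\cdots i_k}x_{i_2}\cdots x_{i_k}$, and $x^{[k-1]}$ is the vector with components $x_i^{k-1}$. A real number $\lambda$ is an H-eigenvalue of $\mathcal T$ with H-eigenvector $x$ if $x\in\mathbb R^n$, $x\ne0$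 and $\mathcal Tx^{k-1}=\lambda x^{[k-1]}$. It is an H$^+$-eigenvalue if it has an H-eigenvector with all components nonnegative, an H$^{++}$-eigenvalue if it has an H-eigenvector with all components positive, and a strict H$^+$-eigenvalue if it is an H$^+$-eigenvalue but not an H$^{++}$-eigenvalue. $\mathbf 1\in\mathbb R^n$ is the all-ones vector and $\mathbf e^{(j)}$ is the $j$th standard unit vector of $\mathbb R^n$. *)

theory Defs
  imports "HOL-Analysis.Analysis"
begin

text \<open>
  The vertex set \<open>{1, ..., n}\<close> is rendered as the universe of a finite type \<open>'n\<close>, so \<open>n = CARD('n)\<close>,
  and a hypergraph is given by its set of edges. The indices of a tensor form a list; a tensor of
  order \<open>k\<close> is only read at lists of length \<open>k\<close>.
\<close>

type_synonym 'n tensor = "'n list \<Rightarrow> real"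

definition k_graph :: "nat \<Rightarrow> 'n::finite set set \<Rightarrow> bool" where
  "k_graph k E \<longleftrightarrow> (\<forall>e\<in>E. card e = k)"

definition vertex_degree :: "'n::finite set set \<Rightarrow> 'n \<Rightarrow> nat" where
  "vertex_degree E i = card {e \<in> E. i \<in> e}"

text \<open>
  The condition \<open>set is \<in> E\<close> below forces the \<open>k\<close> indices to be distinct, as edges have \<open>k\<close> elements.
\<close>

definition adjacency_tensor :: "nat \<Rightarrow> 'n::finite set set \<Rightarrow> 'n tensor" where
  "adjacency_tensor k E is = (if length is = k \<and> set is \<in> E then 1 / fact (k - 1) else 0)"

definition degree_tensor :: "nat \<Rightarrow> 'n::finite set set \<Rightarrow> 'n tensor" where
  "degree_tensor k E is = (if is = replicate k (hd is) then real (vertex_degree E (hd is)) else 0)"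

definition laplacian_tensor :: "nat \<Rightarrow> 'n::finite set set \<Rightarrow> 'n tensor" where
  "laplacian_tensor k E is = degree_tensor k E is - adjacency_tensor k E is"

text \<open>The vector \<open>T x\<^sup>k\<^sup>-\<^sup>1\<close>; the list \<open>js\<close> is \<open>[i\<^sub>2, ..., i\<^sub>k]\<close>.\<close>

definition tensor_apply :: "nat \<Rightarrow> 'n::finite tensor \<Rightarrow> real ^ 'n \<Rightarrow> real ^ 'n" where
  "tensor_apply k T x = (\<chi> i. \<Sum>js | length js = k - 1. T (i # js) * (\<Prod>j\<leftarrow>js. x $ j))"

definition vec_power :: "real ^ 'n \<Rightarrow> nat \<Rightarrow> real ^ 'n" where
  "vec_power x m = (\<chi> i. (x $ i) ^ m)"

definition H_eigenpair :: "nat \<Rightarrow> 'n::finite tensor \<Rightarrow> real \<Rightarrow> real ^ 'n \<Rightarrow> bool" where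
  "H_eigenpair k T \<mu> x \<longleftrightarrow> x \<noteq> 0 \<and> tensor_apply k T x = \<mu> *\<^sub>R vec_power x (k - 1)"

definition H_eigenvalue :: "nat \<Rightarrow> 'n::finite tensor \<Rightarrow> real \<Rightarrow> bool" where
  "H_eigenvalue k T \<mu> \<longleftrightarrow> (\<exists>x. H_eigenpair k T \<mu> x)"

definition Hplus_eigenvalue :: "nat \<Rightarrow> 'n::finite tensor \<Rightarrow> real \<Rightarrow> bool" where
  "Hplus_eigenvalue k T \<mu> \<longleftrightarrow> (\<exists>x. H_eigenpair k T \<mu> x \<and> (\<forall>i. 0 \<le> x $ i))"

definition Hplusplus_eigenvalue :: "nat \<Rightarrow> 'n::finite tensor \<Rightarrow> real \<Rightarrow> bool" where
  "Hplusplus_eigenvalue k T \<mu> \<longleftrightarrow> (\<exists>x. H_eigenpair k T \<mu> x \<and> (\<forall>i. 0 < x $ i))"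

definition strict_Hplus_eigenvalue :: "nat \<Rightarrow> 'n::finite tensor \<Rightarrow> real \<Rightarrow> bool" where
  "strict_Hplus_eigenvalue k T \<mu> \<longleftrightarrow> Hplus_eigenvalue k T \<mu> \<and> \<not> Hplusplus_eigenvalue k T \<mu>"

end

theory Submission
  imports Defs "HOL-Combinatorics.Multiset_Permutations"
begin

text \<open>
  The \<open>i\<close>-th component of \<open>L x\<^sup>k\<^sup>-\<^sup>1\<close> is \<open>d\<^sub>i x\<^sub>i\<^sup>k\<^sup>-\<^sup>1\<close> minus the sum, over the edges \<open>e\<close> through \<open>i\<close>,
  of \<open>\<Prod>j\<in>e - {i}. x\<^sub>j\<close>. Read at an index where \<open>\<bar>x\<^sub>i\<bar>\<close> is maximal, the eigenvalue equation gives
  \<open>\<bar>d\<^sub>i - \<mu>\<bar> \<le> d\<^sub>i\<close>, hence \<open>\<mu> \<ge> 0\<close>. If \<open>x\<close> is positive, then at an index where \<open>x\<^sub>i\<close> is minimal the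
  same equation gives \<open>\<mu> \<le> 0\<close>. For \<open>x = axis j 1\<close> all the products vanish, because
  \<open>e - {i}\<close> has at least two elements.
\<close>

text \<open>Together with \<open>i\<close>, only \<open>k - 1\<close> entries must exhaust a set of
  \<open>k\<close> elements, which leaves no room for a repetition or for a second \<open>i\<close>.
  Hence there are \<open>fact (k - 1)\<close> such lists, exactly the denominator in the adjacency
  tensor.\<close>

lemma index_lists_of_edge:
  assumes "card e = k" and "k \<ge> 1" and "i \<in> e"
  shows "{js. length js = k - 1 \<and> set (i # js) = e} = permutations_of_set (e - {i})"
proof -
  have fin: "finite e"
    using assms by (metis card.infinite not_one_le_zero)
  have c: "card (e - {i}) = k - 1"
    using assms fin by simp
  show ?thesis
  proof (intro equalityI subsetI)
    fix js assume "js \<in> {js. length js = k - 1 \<and> set (i # js) = e}"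
    then have len: "length js = k - 1" and s: "insert i (set js) = e"
      by auto
    have "e - {i} \<subseteq> set js"
      using s by auto
    then have "card (set js) \<ge> k - 1"
      using c by (metis card_mono List.finite_set)
    then have d: "distinct js"
      using len card_length[of js] by (intro card_distinct) simp
    \<comment> \<open>Otherwise the \<open>k - 1\<close> entries of \<open>js\<close> alone would
      cover all \<open>k\<close> elements of \<open>e\<close>.\<close>
    have "i \<notin> set js"
    proof
      assume "i \<in> set js"
      then have "set js = e"
        using s by auto
      then show False
        using assms len card_length[of js] by simp
    qed
    then show "js \<in> permutations_of_set (e - {i})"
      using s d by (auto simp: permutations_of_set_def)
  next
    fix js assume "js \<in> permutations_of_set (e - {i})"
    then have "set js = e - {i}" "distinct js"
      by (auto simp: permutations_of_set_def)
    then show "js \<in> {js. length js = k - 1 \<and> set (i # js) = e}"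
      using c \<open>i \<in> e\<close> distinct_card[of js] by auto
  qed
qed

text \<open>The index lists are grouped by the edge they span with \<open>i\<close>. Each edge
  through \<open>i\<close> then collects \<open>fact (k - 1)\<close> equal terms, and the
  normalisation of the tensor cancels this count.\<close>

lemma adjacency_tensor_apply:
  fixes E :: "'n::finite set set"
  assumes "k_graph k E" and "k \<ge> 1"
  shows "tensor_apply k (adjacency_tensor k E) x $ i =
    (\<Sum>e | e \<in> E \<and> i \<in> e. \<Prod>j\<in>e - {i}. x $ j)"
proof -
  define J where "J = {js :: 'n list. length js = k - 1}"
  have finJ: "finite J"
    unfolding J_def using finite_lists_length_eq[of "UNIV :: 'n set" "k - 1"] by simp
  have "tensor_apply k (adjacency_tensor k E) x $ i =
      (\<Sum>js\<in>J. if set (i # js) \<in> E then (\<Prod>j\<leftarrow>js. x $ j) / fact (k - 1) else 0)"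
    unfolding tensor_apply_def J_def
    using \<open>k \<ge> 1\<close> by (auto intro!: sum.cong simp: adjacency_tensor_def)
  also have "\<dots> = (\<Sum>js | js \<in> J \<and> set (i # js) \<in> E. (\<Prod>j\<leftarrow>js. x $ j) / fact (k - 1))"
    using finJ by (simp only: sum.inter_filter)
  \<comment> \<open>The fibres are those of the map \<open>js\<close> to
    \<open>set (i # js)\<close>, whose values on the remaining lists are edges containing
    \<open>i\<close>.\<close>
  also have "\<dots> = (\<Sum>e | e \<in> E \<and> i \<in> e.
      \<Sum>js | js \<in> {js \<in> J. set (i # js) \<in> E} \<and> set (i # js) = e. (\<Prod>j\<leftarrow>js. x $ j) / fact (k - 1))"
    using finJ by (intro sum.group[symmetric]) auto
  also have "\<dots> = (\<Sum>e | e \<in> E \<and> i \<in> e. \<Prod>j\<in>e - {i}. x $ j)"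
  proof (rule sum.cong[OF refl])
    fix e assume "e \<in> {e. e \<in> E \<and> i \<in> e}"
    then have e: "e \<in> E" "i \<in> e"
      by auto
    then have card: "card e = k"
      using assms by (auto simp: k_graph_def)
    have "{js. js \<in> {js \<in> J. set (i # js) \<in> E} \<and> set (i # js) = e}
        = {js. length js = k - 1 \<and> set (i # js) = e}"
      using e by (auto simp: J_def)
    also have "\<dots> = permutations_of_set (e - {i})"
      using card \<open>k \<ge> 1\<close> e(2) by (rule index_lists_of_edge)
    finally have *: "{js. js \<in> {js \<in> J. set (i # js) \<in> E} \<and> set (i # js) = e}
        = permutations_of_set (e - {i})" .
    \<comment> \<open>The entries of \<open>js\<close> are distinct, so the product along the list
      depends only on its set and is the same for every permutation.\<close>
    have "(\<Sum>js\<in>permutations_of_set (e - {i}). (\<Prod>j\<leftarrow>js. x $ j) / fact (k - 1))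
        = (\<Sum>js\<in>permutations_of_set (e - {i}). (\<Prod>j\<in>e - {i}. x $ j) / fact (k - 1))"
      by (intro sum.cong refl)
        (auto simp: permutations_of_set_def simp flip: prod.distinct_set_conv_list)
    also have "\<dots> = (\<Prod>j\<in>e - {i}. x $ j)"
      using card e by simp
    finally show "(\<Sum>js | js \<in> {js \<in> J. set (i # js) \<in> E} \<and> set (i # js) = e.
        (\<Prod>j\<leftarrow>js. x $ j) / fact (k - 1)) = (\<Prod>j\<in>e - {i}. x $ j)"
      by (simp only: *)
  qed
  finally show ?thesis .
qed

lemma degree_tensor_apply:
  fixes E :: "'n::finite set set"
  assumes "k \<ge> 1"
  shows "tensor_apply k (degree_tensor k E) x $ i = vertex_degree E i * (x $ i) ^ (k - 1)"
proof -
  have fin: "finite {js :: 'n list. length js = k - 1}"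
    using finite_lists_length_eq[of "UNIV :: 'n set" "k - 1"] by simp
  have *: "i # js = replicate k i \<longleftrightarrow> js = replicate (k - 1) i" for js
    using assms by (cases k) auto
  have "tensor_apply k (degree_tensor k E) x $ i =
      (\<Sum>js | length js = k - 1. if js = replicate (k - 1) i
         then vertex_degree E i * (\<Prod>j\<leftarrow>js. x $ j) else 0)"
    unfolding tensor_apply_def by (auto intro!: sum.cong simp: degree_tensor_def *)
  also have "\<dots> = vertex_degree E i * (x $ i) ^ (k - 1)"
    using fin by (simp add: sum.delta prod_list_replicate)
  finally show ?thesis .
qed

lemma laplacian_tensor_apply:
  fixes E :: "'n::finite set set"
  assumes "k_graph k E" and "k \<ge> 1"
  shows "tensor_apply k (laplacian_tensor k E) x $ i =
    vertex_degree E i * (x $ i) ^ (k - 1) - (\<Sum>e | e \<in> E \<and> i \<in> e. \<Prod>j\<in>e - {i}. x $ j)"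
proof -
  have "tensor_apply k (laplacian_tensor k E) x $ i =
      tensor_apply k (degree_tensor k E) x $ i - tensor_apply k (adjacency_tensor k E) x $ i"
    by (simp add: tensor_apply_def laplacian_tensor_def left_diff_distrib sum_subtractf)
  then show ?thesis
    by (simp only: degree_tensor_apply[OF assms(2)] adjacency_tensor_apply[OF assms])
qed

text \<open>Isolating the sum over edges puts the equation in the form needed at an extremal vertex:
  that sum has \<open>vertex_degree E i\<close> terms, each a product of \<open>k - 1\<close>
  components, comparable with \<open>(x $ i) ^ (k - 1)\<close>.\<close>

lemma H_eigenpair_laplacian_iff:
  fixes E :: "'n::finite set set" and \<mu> :: real
  assumes "k_graph k E" and "k \<ge> 1"
  shows "H_eigenpair k (laplacian_tensor k E) \<mu> x \<longleftrightarrow> x \<noteq> 0 \<and>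
    (\<forall>i. (\<Sum>e | e \<in> E \<and> i \<in> e. \<Prod>j\<in>e - {i}. x $ j) = (real (vertex_degree E i) - \<mu>) * (x $ i) ^ (k - 1))"
proof -
  have "a - b = \<mu> * c \<longleftrightarrow> b = a - \<mu> * c" for a b c :: real
    by linarith
  then show ?thesis
    by (simp add: H_eigenpair_def vec_eq_iff[of "tensor_apply _ _ _"] laplacian_tensor_apply[OF assms]
        vec_power_def left_diff_distrib)
qed

lemma H_eigenvalue_laplacian_nonneg:
  fixes E :: "'n::finite set set" and \<mu> :: real
  assumes "k_graph k E" and "k \<ge> 1" and "H_eigenvalue k (laplacian_tensor k E) \<mu>"
  shows "0 \<le> \<mu>"
proof -
  obtain x where x: "x \<noteq> 0"
    and eq: "\<And>i. (\<Sum>e | e \<in> E \<and> i \<in> e. \<Prod>j\<in>e - {i}. x $ j)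
      = (real (vertex_degree E i) - \<mu>) * (x $ i) ^ (k - 1)"
    using assms(3) unfolding H_eigenvalue_def H_eigenpair_laplacian_iff[OF assms(1,2)] by blast
  have "Max (range (\<lambda>i. \<bar>x $ i\<bar>)) \<in> range (\<lambda>i. \<bar>x $ i\<bar>)"
    by (intro Max_in) auto
  then obtain i where "\<bar>x $ i\<bar> = Max (range (\<lambda>i. \<bar>x $ i\<bar>))"
    by (metis imageE)
  then have max: "\<bar>x $ j\<bar> \<le> \<bar>x $ i\<bar>" for j
    by simp
  \<comment> \<open>A zero maximum would force \<open>x = 0\<close>. Positivity allows the common
    factor \<open>\<bar>x $ i\<bar> ^ (k - 1)\<close> to be cancelled at the end.\<close>
  have pos: "\<bar>x $ i\<bar> > 0"
    using x max by (metis abs_le_zero_iff abs_ge_zero order_le_less vec_eq_iff zero_index)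
  have "\<bar>vertex_degree E i - \<mu>\<bar> * \<bar>x $ i\<bar> ^ (k - 1)
      = \<bar>\<Sum>e | e \<in> E \<and> i \<in> e. \<Prod>j\<in>e - {i}. x $ j\<bar>"
    by (simp add: eq abs_mult power_abs)
  also have "\<dots> \<le> (\<Sum>e | e \<in> E \<and> i \<in> e. \<bar>x $ i\<bar> ^ (k - 1))"
  proof (rule order_trans[OF sum_abs], rule sum_mono)
    fix e assume "e \<in> {e. e \<in> E \<and> i \<in> e}"
    then have "card (e - {i}) = k - 1"
      using assms by (auto simp: k_graph_def)
    moreover have "(\<Prod>j\<in>e - {i}. \<bar>x $ j\<bar>) \<le> (\<Prod>j\<in>e - {i}. \<bar>x $ i\<bar>)"
      using max by (intro prod_mono) auto
    ultimately show "\<bar>\<Prod>j\<in>e - {i}. x $ j\<bar> \<le> \<bar>x $ i\<bar> ^ (k - 1)"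
      by (simp add: abs_prod)
  qed
  also have "\<dots> = vertex_degree E i * \<bar>x $ i\<bar> ^ (k - 1)"
    by (simp add: vertex_degree_def)
  finally have "\<bar>vertex_degree E i - \<mu>\<bar> \<le> vertex_degree E i"
    using pos by simp
  then show ?thesis
    by linarith
qed

lemma Hplusplus_eigenvalue_laplacian_nonpos:
  fixes E :: "'n::finite set set" and \<mu> :: real
  assumes "k_graph k E" and "k \<ge> 1" and "Hplusplus_eigenvalue k (laplacian_tensor k E) \<mu>"
  shows "\<mu> \<le> 0"
proof -
  obtain x where x: "\<And>i. 0 < x $ i"
    and eq: "\<And>i. (\<Sum>e | e \<in> E \<and> i \<in> e. \<Prod>j\<in>e - {i}. x $ j)
      = (real (vertex_degree E i) - \<mu>) * (x $ i) ^ (k - 1)"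
    using assms(3) unfolding Hplusplus_eigenvalue_def H_eigenpair_laplacian_iff[OF assms(1,2)]
    by blast
  have "Min (range (\<lambda>i. x $ i)) \<in> range (\<lambda>i. x $ i)"
    by (intro Min_in) auto
  then obtain i where "x $ i = Min (range (\<lambda>i. x $ i))"
    by (metis imageE)
  then have min: "x $ i \<le> x $ j" for j
    by simp
  have "vertex_degree E i * (x $ i) ^ (k - 1) = (\<Sum>e | e \<in> E \<and> i \<in> e. (x $ i) ^ (k - 1))"
    by (simp add: vertex_degree_def)
  also have "\<dots> \<le> (\<Sum>e | e \<in> E \<and> i \<in> e. \<Prod>j\<in>e - {i}. x $ j)"
  proof (rule sum_mono)
    fix e assume "e \<in> {e. e \<in> E \<and> i \<in> e}"
    then have "card (e - {i}) = k - 1"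
      using assms by (auto simp: k_graph_def)
    \<comment> \<open>Comparing the products factor by factor is legitimate because all components
      are positive.\<close>
    moreover have "(\<Prod>j\<in>e - {i}. x $ i) \<le> (\<Prod>j\<in>e - {i}. x $ j)"
      using min x by (intro prod_mono) (auto intro: less_imp_le)
    ultimately show "(x $ i) ^ (k - 1) \<le> (\<Prod>j\<in>e - {i}. x $ j)"
      by simp
  qed
  also have "\<dots> = (real (vertex_degree E i) - \<mu>) * (x $ i) ^ (k - 1)"
    by (rule eq)
  finally have "real (vertex_degree E i) \<le> vertex_degree E i - \<mu>"
    using x by simp
  then show ?thesis
    by simp
qed

text \<open>Every product equals 1, so both sides of the equation count the edges through
  \<open>i\<close>.\<close>

lemma H_eigenpair_laplacian_ones:
  fixes E :: "'n::finite set set"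
  assumes "k_graph k E" and "k \<ge> 1"
  shows "H_eigenpair k (laplacian_tensor k E) 0 (\<chi> i. 1)"
  by (simp add: H_eigenpair_laplacian_iff[OF assms] vertex_degree_def vec_eq_iff)

lemma H_eigenpair_laplacian_axis:
  fixes E :: "'n::finite set set"
  assumes "k_graph k E" and "k \<ge> 3"
  shows "H_eigenpair k (laplacian_tensor k E) (vertex_degree E j) (axis j 1)"
proof -
  have prod: "(\<Prod>l\<in>e - {i}. axis j 1 $ l :: real) = 0" if e: "e \<in> E" "i \<in> e" for e i
  proof -
    \<comment> \<open>This is where \<open>k \<ge> 3\<close> is essential: \<open>e\<close> must
      have a vertex other than \<open>i\<close> and \<open>j\<close>, and \<open>axis j 1\<close>
      vanishes there.\<close>
    have "card {i, j} < card e"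
      using assms e by (simp add: k_graph_def card_insert_if)
    then have "\<not> e \<subseteq> {i, j}"
      using card_mono[of "{i, j}" e] by auto
    then show ?thesis
      by (auto simp: axis_def intro!: prod_zero)
  qed
  have sum: "(\<Sum>e | e \<in> E \<and> i \<in> e. \<Prod>l\<in>e - {i}. axis j 1 $ l :: real) = 0" for i
    using prod by (intro sum.neutral) blast
  \<comment> \<open>For \<open>i = j\<close> the first factor vanishes; otherwise the second is a
    positive power of 0.\<close>
  have "(real (vertex_degree E i) - vertex_degree E j) * (axis j 1 $ i) ^ (k - 1) = 0" for i
    using assms by (auto simp: axis_def)
  with sum show ?thesis
    using assms by (simp add: H_eigenpair_laplacian_iff axis_eq_0_iff del: prod_zero_iff)
qed

theorem theorem4:
  fixes k :: nat and E :: "'n::finite set set"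
  assumes "k \<ge> 3"
    and "k_graph k E"
    and "\<forall>i. \<exists>e\<in>E. i \<in> e"
  shows "(\<forall>j. strict_Hplus_eigenvalue k (laplacian_tensor k E) (real (vertex_degree E j)) \<and>
              H_eigenpair k (laplacian_tensor k E) (real (vertex_degree E j)) (axis j 1)) \<and>
         (\<forall>\<mu>. Hplusplus_eigenvalue k (laplacian_tensor k E) \<mu> \<longleftrightarrow> \<mu> = 0) \<and>
         H_eigenpair k (laplacian_tensor k E) 0 (\<chi> i. 1) \<and>
         H_eigenvalue k (laplacian_tensor k E) 0 \<and>
         (\<forall>\<mu>. H_eigenvalue k (laplacian_tensor k E) \<mu> \<longrightarrow> 0 \<le> \<mu>)"
proof -
  let ?L = "laplacian_tensor k E"
  have k: "k \<ge> 1"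
    using assms(1) by simp
  have ones: "H_eigenpair k ?L 0 (\<chi> i. 1)"
    using assms(2) k by (rule H_eigenpair_laplacian_ones)
  have nonneg: "0 \<le> \<mu>" if "H_eigenvalue k ?L \<mu>" for \<mu>
    using assms(2) k that by (rule H_eigenvalue_laplacian_nonneg)
  have "Hplusplus_eigenvalue k ?L 0"
    unfolding Hplusplus_eigenvalue_def using ones by (intro exI conjI) auto
  moreover have "\<mu> = 0" if "Hplusplus_eigenvalue k ?L \<mu>" for \<mu>
  proof (rule antisym)
    show "\<mu> \<le> 0"
      using assms(2) k that by (rule Hplusplus_eigenvalue_laplacian_nonpos)
    show "0 \<le> \<mu>"
      using that by (intro nonneg) (auto simp: Hplusplus_eigenvalue_def H_eigenvalue_def)
  qed
  ultimately have pp: "Hplusplus_eigenvalue k ?L \<mu> \<longleftrightarrow> \<mu> = 0" for \<mu>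
    by blast
  have axis: "H_eigenpair k ?L (vertex_degree E j) (axis j 1)" for j
    using assms(2,1) by (rule H_eigenpair_laplacian_axis)
  \<comment> \<open>Strictness reduces to this: by \<open>pp\<close> the only H++-eigenvalue is 0,
    and a vertex lying in an edge has nonzero degree.\<close>
  have "vertex_degree E j \<noteq> 0" for j
    using assms(3) by (auto simp: vertex_degree_def)
  moreover have "Hplus_eigenvalue k ?L (vertex_degree E j)" for j
    unfolding Hplus_eigenvalue_def using axis[of j] by (intro exI conjI) (auto simp: axis_def)
  ultimately have "strict_Hplus_eigenvalue k ?L (vertex_degree E j)" for j
    by (simp add: strict_Hplus_eigenvalue_def pp)
  then show ?thesis
    using axis pp ones nonneg by (auto simp: H_eigenvalue_def)
qed

end
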